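(* Let $n$ be a positive integer, and let $$\mathcal{R}_n(q)=\begin{cases}(-1)^m(1+q^m)q^{m(3m-1)/2}, & \text{if } n=3m,\\ (-1)^m q^{m(3m+1)/2}, & \text{if } n=3m+1,\\ (-1)^m q^{m(3m-1)/2}, & \text{if } n=3m-1,\end{cases}$$ where in each case $m$ is the (non-negative) integer determined by $n$ through the indicated relation. Then $$\sum_{k=1}^{\lfloor n/2\rfloor}\frac{q^{-k(k-1)}}{[2k]_q}{2k\brack k}\equiv\frac{(1-q)(1-\mathcal{R}_n(q))}{1-q^n}\pmod{\Phi_n(q)}.$$
   Context: Here $q$ is an indeterminate and $\lfloor x\rfloor$ denotes the integral part of the real number $x$. The $q$-integers are $[n]_q=(1-q^n)/(1-q)$ for $n\ge 1$. The $q$-binomial coefficients are ${n\brack k}=\dfrac{(1-q^n)(1-q^{n-1})\cdots(1-q^{n-k+1})}{(1-q)(1-q^2)\cdots(1-q^k)}$ if $0\le k\le n$, and ${n\brack k}=0$ otherwise. The polynomial $\Phi_n(q)=\prod_{1\le k\le n,\ \gcd(n,k)=1}(q-\zeta^k)$, with $\zeta$ a primitive $n$th root of unity, is the $n$th cyclotomic polynomial. Congruences between rational functions: for rational functions $A(q),B(q)\in\mathbb{Z}(q)$ and a polynomial $P(q)\in\mathbb{Z}[q]$, $A(q)\equiv B(q)\pmod{P(q)}$ means that the rational function $A(q)-B(q)$ can be written as $A_1(q)/A_2(q)$ with $A_1(q),A_2(q)\in\mathbb{Z}[q]$, $A_1(q)$ divisible by $P(q)$ and $A_2(q)$ coprime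 with $P(q)$. An empty sum is $0$. *)

theory Defs
  imports
    "HOL-Computational_Algebra.Computational_Algebra"
    "HOL-Number_Theory.Totient"
begin

section \<open>Cyclotomic polynomials\<close>

definition cyclotomic_complex :: "nat \<Rightarrow> complex poly" where
  "cyclotomic_complex n =
     (\<Prod>k | 1 \<le> k \<and> k \<le> n \<and> gcd n k = 1. [:- (cis (2 * pi / real n) ^ k), 1:])"

text \<open>
  The product has integer coefficients; \<open>cyclotomic n\<close> is that product regarded as an
  element of \<open>\<int>[q]\<close>. That the description is proper is the lemma
  \<open>of_int_cyclotomic\<close> below.
\<close>

definition cyclotomic :: "nat \<Rightarrow> int poly" where
  "cyclotomic n = (THE P. map_poly of_int P = cyclotomic_complex n)"

lemma of_int_poly_inject:
  "map_poly (of_int :: int \<Rightarrow> complex) p = map_poly of_int q \<longleftrightarrow> p = q"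
  by (auto simp: poly_eq_iff coeff_map_poly)

lemma of_int_poly_add:
  "map_poly (of_int :: int \<Rightarrow> complex) (p + q) = map_poly of_int p + map_poly of_int q"
  by (auto simp: poly_eq_iff coeff_map_poly)

lemma of_int_poly_diff:
  "map_poly (of_int :: int \<Rightarrow> complex) (p - q) = map_poly of_int p - map_poly of_int q"
  by (auto simp: poly_eq_iff coeff_map_poly)

lemma of_int_poly_mult:
  "map_poly (of_int :: int \<Rightarrow> complex) (p * q) = map_poly of_int p * map_poly of_int q"
  by (auto simp: poly_eq_iff coeff_map_poly coeff_mult)

lemma of_int_poly_prod:
  "map_poly (of_int :: int \<Rightarrow> complex) (prod f A) = (\<Prod>x\<in>A. map_poly of_int (f x))"
  by (induction A rule: infinite_finite_induct) (auto simp: of_int_poly_mult)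

lemma degree_of_int_poly:
  "degree (map_poly (of_int :: int \<Rightarrow> complex) p) = degree p"
  by (rule degree_map_poly) auto

lemma monic_prod_linear:
  "lead_coeff (\<Prod>k\<in>A. [:- c k, 1 :: complex:]) = 1"
  by (simp add: lead_coeff_prod)

lemma cyclotomic_complex_altdef:
  "cyclotomic_complex n = (\<Prod>k\<in>totatives n. [:- cis (2 * pi * real k / real n), 1:])"
  unfolding cyclotomic_complex_def
  by (rule prod.cong)
    (auto simp: totatives_def DeMoivre mult_ac coprime_iff_gcd_eq_1 gcd.commute)

lemma monom_minus_1_eq_prod_linear:
  assumes "n > 0"
  shows "monom 1 n - 1 = (\<Prod>k\<in>{0<..n}. [:- cis (2 * pi * real k / real n), 1:])"
proof -
  let ?p = "monom 1 n - 1 :: complex poly"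
  have deg: "degree ?p = n" "lead_coeff ?p = 1"
  proof -
    have "degree ?p = degree (monom (1::complex) n)"
      using assms by (simp only: diff_conv_add_uminus, intro degree_add_eq_left)
        (auto simp: degree_monom_eq)
    then show d: "degree ?p = n" by (simp add: degree_monom_eq)
    show "lead_coeff ?p = 1" unfolding d using assms by simp
  qed
  have root: "poly ?p z = 0 \<longleftrightarrow> z ^ n = 1" for z by (simp add: poly_monom)
  have "rsquarefree ?p"
    unfolding rsquarefree_roots
  proof (intro allI notI, elim conjE)
    fix a assume a: "poly ?p a = 0" "poly (pderiv ?p) a = 0"
    have "a ^ n = 1" using a(1) root by simp
    moreover have "a = 0 \<or> n = 0"
      using a(2) by (auto simp: pderiv_diff pderiv_monom poly_monom)
    ultimately show False using assms by (auto simp: power_0_left)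
  qed
  from complex_poly_decompose_rsquarefree[OF this]
  have "?p = (\<Prod>z | z ^ n = 1. [:- z, 1:])"
    using deg root by simp
  also have "\<dots> = (\<Prod>k<n. [:- cis (2 * pi * real k / real n), 1:])"
    by (rule prod.reindex_bij_betw[OF bij_betw_roots_unity[OF assms], symmetric])
  also have "\<dots> = (\<Prod>k\<in>{0<..n}. [:- cis (2 * pi * real k / real n), 1:])"
  proof -
    have *: "{..<n} = insert 0 {0<..<n}" "{0<..n} = insert n {0<..<n}" using assms by auto
    show ?thesis unfolding * using assms by (subst (1 2) prod.insert) auto
  qed
  finally show ?thesis .
qed

lemma prod_cyclotomic_complex:
  assumes "n > 0"
  shows "(\<Prod>d | d dvd n. cyclotomic_complex (n div d)) = monom 1 n - 1"
proof -
  let ?f = "\<lambda>k. [:- cis (2 * pi * real k / real n), 1:]"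
  have "monom 1 n - 1 = prod ?f {0<..n}"
    by (rule monom_minus_1_eq_prod_linear[OF assms])
  also have "\<dots> = (\<Prod>d | d dvd n. prod ?f {k \<in> {0<..n}. gcd k n = d})"
    by (rule prod.group[symmetric]) (use assms in auto)
  also have "\<dots> = (\<Prod>d | d dvd n. cyclotomic_complex (n div d))"
  proof (rule prod.cong)
    fix d assume d: "d \<in> {d. d dvd n}"
    have dpos: "d > 0" using d assms by (auto intro: Nat.gr0I)
    have "prod ?f {k \<in> {0<..n}. gcd k n = d} = (\<Prod>k\<in>totatives (n div d). ?f (k * d))"
      by (rule prod.reindex_bij_betw[symmetric], rule bij_betw_totatives_gcd_eq)
        (use d assms in auto)
    also have "\<dots> = cyclotomic_complex (n div d)"
      unfolding cyclotomic_complex_altdef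
      by (rule prod.cong) (use d dpos assms in \<open>auto simp: real_of_nat_div field_simps\<close>)
    finally show "prod ?f {k \<in> {0<..n}. gcd k n = d} = cyclotomic_complex (n div d)" .
  qed simp
  finally show ?thesis ..
qed

lemma cyclotomic_complex_integral: "\<exists>P. map_poly of_int P = cyclotomic_complex n"
proof (induction n rule: less_induct)
  case (less n)
  show ?case
  proof (cases "n = 0")
    case True
    then have "map_poly of_int 1 = cyclotomic_complex n"
      by (simp add: cyclotomic_complex_altdef)
    then show ?thesis by blast
  next
    case False
    let ?h = "map_poly (of_int :: int \<Rightarrow> complex)"
    define D where "D = {d. d dvd n} - {1}"
    have "\<exists>P. ?h P = cyclotomic_complex (n div d)" if "d \<in> D" for d
    proof -
      have "d > 1" using that False by (cases d) (auto simp: D_def)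
      then show ?thesis using less.IH[of "n div d"] False by simp
    qed
    then obtain P where P: "\<And>d. d \<in> D \<Longrightarrow> ?h (P d) = cyclotomic_complex (n div d)"
      by metis
    define Q where "Q = prod P D"
    have hQ: "?h Q = (\<Prod>d\<in>D. cyclotomic_complex (n div d))"
      unfolding Q_def by (simp add: of_int_poly_prod P)
    have "lead_coeff (?h Q) = 1"
      unfolding hQ by (simp add: lead_coeff_prod cyclotomic_complex_altdef)
    then have lcQ: "lead_coeff Q = 1"
      by (simp add: degree_of_int_poly coeff_map_poly)
    then have Q0: "Q \<noteq> 0" by auto
    have "finite {d. d dvd n}" using False by simp
    then have "monom 1 n - 1 = cyclotomic_complex (n div 1) * ?h Q"
      unfolding hQ D_def using prod_cyclotomic_complex[of n] False
      by (subst prod.remove[of _ 1, symmetric]) auto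
    moreover have "monom 1 n - 1 = ?h (monom 1 n - 1)"
      by (simp add: of_int_poly_diff map_poly_monom)
    ultimately have eq: "?h (monom 1 n - 1) = cyclotomic_complex n * ?h Q" by simp
    obtain S R where SR: "pseudo_divmod (monom 1 n - 1) Q = (S, R)" by fastforce
    have div: "monom 1 n - 1 = Q * S + R"
      using pseudo_divmod(1)[OF Q0 SR] lcQ by simp
    have small: "R = 0 \<or> degree R < degree Q" by (rule pseudo_divmod(2)[OF Q0 SR])
    have R: "?h R = (cyclotomic_complex n - ?h S) * ?h Q"
      using eq unfolding div by (simp add: of_int_poly_add of_int_poly_mult algebra_simps)
    have "cyclotomic_complex n - ?h S = 0"
    proof (rule ccontr)
      assume nz: "cyclotomic_complex n - ?h S \<noteq> 0"
      have hQ0: "?h Q \<noteq> 0" using Q0 of_int_poly_inject[of Q 0] by auto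
      then have "degree (?h R) = degree (cyclotomic_complex n - ?h S) + degree (?h Q)"
        unfolding R using nz by (rule degree_mult_eq[rotated])
      moreover have "R \<noteq> 0" using R nz hQ0 by auto
      ultimately show False using small by (simp add: degree_of_int_poly)
    qed
    then show ?thesis by (intro exI[of _ S]) simp
  qed
qed

lemma of_int_cyclotomic: "map_poly of_int (cyclotomic n) = cyclotomic_complex n"
proof -
  obtain P where P: "map_poly of_int P = cyclotomic_complex n"
    using cyclotomic_complex_integral by blast
  show ?thesis unfolding cyclotomic_def
    by (rule theI[of _ P]) (use P in \<open>auto simp flip: of_int_poly_inject\<close>)
qed


section \<open>Rational functions and congruences\<close>

text \<open>
  \<open>\<int>(q)\<close> is the fraction field of \<open>\<int>[q]\<close>, with \<open>q\<close> the indeterminate.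
\<close>

type_synonym ratfun = "int poly fract"

definition qvar :: ratfun where
  "qvar = to_fract [:0, 1:]"

definition ratfun_cong :: "ratfun \<Rightarrow> ratfun \<Rightarrow> int poly \<Rightarrow> bool" where
  "ratfun_cong A B P \<longleftrightarrow>
     (\<exists>A1 A2 :: int poly. A2 \<noteq> 0 \<and> A - B = to_fract A1 / to_fract A2 \<and> P dvd A1 \<and> coprime A2 P)"


section \<open>\<open>q\<close>-analogues\<close>

definition q_int :: "nat \<Rightarrow> ratfun" where
  "q_int n = (1 - qvar ^ n) / (1 - qvar)"

definition q_binom :: "nat \<Rightarrow> nat \<Rightarrow> ratfun" where
  "q_binom n k =
     (if k \<le> n then (\<Prod>i<k. 1 - qvar ^ (n - i)) / (\<Prod>i=1..k. 1 - qvar ^ i) else 0)"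

text \<open>
  Here \<open>m\<close> is recovered from \<open>n\<close>; the lemmas below restate the definition
  in terms of \<open>m\<close>. The exponents are pentagonal numbers, so the divisions by 2 are exact, and the
  subtraction does not truncate since \<open>m \<ge> 1\<close> wherever it occurs (for \<open>n > 0\<close>).
\<close>

definition R_poly :: "nat \<Rightarrow> ratfun" where
  "R_poly n =
     (if n mod 3 = 0 then
        let m = n div 3 in (-1) ^ m * (1 + qvar ^ m) * qvar ^ (m * (3 * m - 1) div 2)
      else if n mod 3 = 1 then
        let m = n div 3 in (-1) ^ m * qvar ^ (m * (3 * m + 1) div 2)
      else
        let m = (n + 1) div 3 in (-1) ^ m * qvar ^ (m * (3 * m - 1) div 2))"

lemma R_poly_3m:
  "R_poly (3 * m) = (-1) ^ m * (1 + qvar ^ m) * qvar ^ (m * (3 * m - 1) div 2)"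
  by (simp add: R_poly_def)

lemma R_poly_3m_plus_1:
  "R_poly (3 * m + 1) = (-1) ^ m * qvar ^ (m * (3 * m + 1) div 2)"
proof -
  have "(3 * m + 1) mod 3 = 1" "(3 * m + 1) div 3 = m" by presburger+
  then show ?thesis by (simp add: R_poly_def)
qed

lemma R_poly_3m_minus_1:
  assumes "m > 0"
  shows "R_poly (3 * m - 1) = (-1) ^ m * qvar ^ (m * (3 * m - 1) div 2)"
proof -
  obtain j where m: "m = Suc j" using assms by (cases m) auto
  have *: "3 * m - 1 = 2 + 3 * j" by (simp add: m)
  have "(3 * m - 1) mod 3 = 2" unfolding * by presburger
  moreover have "(3 * m - 1 + 1) div 3 = m" using assms by simp
  ultimately show ?thesis unfolding R_poly_def Let_def by (simp only:) simp
qed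

end

theory Submission
  imports Defs
begin

text \<open>
  The right-hand side is, without any congruence, a sum of the same length as the left-hand side,
  and modulo \<open>\<Phi>\<^sub>n\<close> the two sums agree term by term. Write \<open>[n, k]\<close> for the Gaussian binomial and
  \<open>c k = k (k - 1) / 2\<close>.

  The exact identity is
  \[ \mathcal{R}_n(q) = \sum_{k \le n/2} (-1)^k q^{c(k)} \frac{1 - q^n}{1 - q^{n-k}} [n - k, k], \]
  a \<open>q\<close>-analogue of the formula for the Lucas polynomial at \<open>-1\<close>, whose values have period 6
  (\<open>one_minus_R_poly_sum\<close>). Splitting the Lucas factor with
  \<open>1 - q^n = (1 - q^(n-k)) + q^(n-k) (1 - q^k)\<close> gives \<open>R\<^sub>n = F\<^sub>n - q^(n-1) F\<^sub>n\<^sub>-\<^sub>2\<close> for the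
  \<open>q\<close>-Fibonacci sums \<open>F\<^sub>n = \<Sum> (-1)^k q^(c k) [n - k, k]\<close>. The two \<open>q\<close>-Pascal rules yield
  \<open>F\<^sub>n + q^(n-2) F\<^sub>n\<^sub>-\<^sub>3 = F\<^sub>n\<^sub>-\<^sub>1 + q^(n-3) F\<^sub>n\<^sub>-\<^sub>4\<close>, so that \<open>F\<^sub>n + q^(n-2) F\<^sub>n\<^sub>-\<^sub>3\<close> is independent
  of \<open>n\<close>; it vanishes at \<open>n = 3\<close>, whence \<open>F\<^sub>n = - q^(n-2) F\<^sub>n\<^sub>-\<^sub>3\<close> (\<open>q_fib_add_3\<close>). This
  first-order recurrence in steps of 3 produces the pentagonal exponents and the three cases of
  \<open>R_poly\<close>.

  For the congruence, both terms of index \<open>k\<close> are written over the denominator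
  \<open>q^(k (k-1)) (1 - q) \<dots> (1 - q^k)\<close>. The numerators are then \<open>1 - q\<close> times the products over
  \<open>k < j < 2 k\<close> of \<open>1 - q^j\<close> and of \<open>q^n - q^j\<close>. These agree modulo \<open>1 - q^n\<close>, hence modulo
  \<open>\<Phi>\<^sub>n\<close>, and the denominator is coprime to \<open>\<Phi>\<^sub>n\<close> because \<open>k < n\<close> (\<open>term_cong\<close>).
\<close>

section \<open>Gaussian binomials\<close>

lemma to_fract_power: "to_fract (p ^ k) = to_fract p ^ k"
  by (induction k) auto

lemma to_fract_prod: "to_fract (prod f A) = (\<Prod>x\<in>A. to_fract (f x))"
  by (induction A rule: infinite_finite_induct) auto

lemma qvar_power: "qvar ^ k = to_fract (monom 1 k)"
  by (simp add: qvar_def flip: to_fract_power monom_altdef[of 1, simplified])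

lemma qvar_nonzero [simp]: "qvar \<noteq> 0"
  by (simp add: qvar_def)

lemma qvar_power_eq_1_iff [simp]: "qvar ^ k = 1 \<longleftrightarrow> k = 0"
proof
  assume "qvar ^ k = 1"
  then have "to_fract (monom (1 :: int) k) = to_fract 1"
    by (simp add: qvar_power)
  then have "monom 1 k = (1 :: int poly)"
    unfolding to_fract_eq_iff .
  then have "degree (monom (1 :: int) k) = 0" by simp
  then show "k = 0" by (simp add: degree_monom_eq)
qed simp

lemma one_minus_qvar_power_nonzero: "k > 0 \<Longrightarrow> 1 - qvar ^ k \<noteq> 0"
  by simp

text \<open>
  For \<open>k > n\<close> the product in the numerator contains the factor \<open>1 - q^0\<close>, so one formula covers
  both cases of the definition. This frees the two relations that follow from side conditions.
\<close>

lemma q_binom_altdef: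
  "q_binom n k = (\<Prod>i<k. 1 - qvar ^ (n - i)) / (\<Prod>i=1..k. 1 - qvar ^ i)"
proof (cases "k \<le> n")
  case False
  then have "(\<Prod>i<k. 1 - qvar ^ (n - i)) = 0"
    by (intro prod_zero) (auto intro!: bexI[of _ n])
  with False show ?thesis by (simp add: q_binom_def)
qed (simp add: q_binom_def)

lemma q_binom_0 [simp]: "q_binom n 0 = 1"
  by (simp add: q_binom_def)

lemma q_binom_eq_0 [simp]: "n < k \<Longrightarrow> q_binom n k = 0"
  by (simp add: q_binom_def)

lemma q_binom_absorption:
  "(1 - qvar ^ Suc k) * q_binom (Suc n) (Suc k) = (1 - qvar ^ Suc n) * q_binom n k"
proof -
  have "1 - qvar ^ Suc k \<noteq> 0" by (rule one_minus_qvar_power_nonzero) simp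
  then show ?thesis
    unfolding q_binom_altdef prod.lessThan_Suc_shift by simp
qed

lemma q_binom_step:
  "(1 - qvar ^ Suc k) * q_binom n (Suc k) = (1 - qvar ^ (n - k)) * q_binom n k"
proof -
  have "1 - qvar ^ Suc k \<noteq> 0" by (rule one_minus_qvar_power_nonzero) simp
  then show ?thesis
    unfolding q_binom_altdef by simp
qed

text \<open>
  After multiplication by \<open>1 - q^(k+1)\<close> every term of either Pascal rule becomes a multiple of
  \<open>[n, k]\<close>, and what remains is the splitting
  \<open>1 - q^(n+1) = (1 - q^(n-k)) + q^(n-k) (1 - q^(k+1))\<close> or its mirror image
  \<open>1 - q^(n+1) = q^(k+1) (1 - q^(n-k)) + (1 - q^(k+1))\<close>.
\<close>

lemma q_pascal_upper:
  assumes "k \<le> n"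
  shows "q_binom (Suc n) (Suc k) = q_binom n (Suc k) + qvar ^ (n - k) * q_binom n k"
proof -
  have e: "qvar ^ (n - k) * qvar ^ Suc k = qvar ^ Suc n"
    using assms by (simp flip: power_add power_Suc)
  have "(1 - qvar ^ Suc k) * q_binom (Suc n) (Suc k)
      = (1 - qvar ^ (n - k)) * q_binom n k + qvar ^ (n - k) * (1 - qvar ^ Suc k) * q_binom n k"
    unfolding q_binom_absorption e[symmetric] by (simp add: algebra_simps)
  also have "\<dots> = (1 - qvar ^ Suc k) * (q_binom n (Suc k) + qvar ^ (n - k) * q_binom n k)"
    unfolding q_binom_step[symmetric] by (simp add: algebra_simps)
  finally show ?thesis
    using one_minus_qvar_power_nonzero[of "Suc k"] by (simp del: power_Suc)
qed

lemma q_pascal_lower: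
  assumes "k \<le> n"
  shows "q_binom (Suc n) (Suc k) = qvar ^ Suc k * q_binom n (Suc k) + q_binom n k"
proof -
  have e: "qvar ^ (n - k) * qvar ^ Suc k = qvar ^ Suc n"
    using assms by (simp flip: power_add power_Suc)
  have "(1 - qvar ^ Suc k) * q_binom (Suc n) (Suc k)
      = qvar ^ Suc k * ((1 - qvar ^ (n - k)) * q_binom n k) + (1 - qvar ^ Suc k) * q_binom n k"
    unfolding q_binom_absorption e[symmetric] by (simp add: algebra_simps)
  also have "\<dots> = (1 - qvar ^ Suc k) * (qvar ^ Suc k * q_binom n (Suc k) + q_binom n k)"
    unfolding q_binom_step[symmetric] by (simp add: algebra_simps)
  finally show ?thesis
    using one_minus_qvar_power_nonzero[of "Suc k"] by (simp del: power_Suc)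
qed

section \<open>A pentagonal recurrence\<close>

definition alt_weight :: "nat \<Rightarrow> ratfun" where
  "alt_weight k = (-1) ^ k * qvar ^ (k choose 2)"

text \<open>
  At \<open>q = 1\<close> this is the Fibonacci polynomial at \<open>-1\<close>, with values
  \<open>1, 1, 0, -1, -1, 0, \<dots>\<close>. The sum stops at \<open>n div 2\<close>, where the binomials begin to vanish;
  further indices would meet the truncated subtraction \<open>n - k\<close>.
\<close>

definition q_fib :: "nat \<Rightarrow> ratfun" where
  "q_fib n = (\<Sum>k\<le>n div 2. alt_weight k * q_binom (n - k) k)"

lemma alt_weight_0 [simp]: "alt_weight 0 = 1"
  by (simp add: alt_weight_def numeral_2_eq_2)

lemma alt_weight_Suc: "alt_weight (Suc k) = - (qvar ^ k * alt_weight k)"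
  by (simp add: alt_weight_def numeral_2_eq_2 power_add)

text \<open>
  Both Pascal rules, applied to the terms of index \<open>k + 1\<close> of a sum for \<open>n + 2\<close>, leave one part of
  this shape and one part that is again a sum for \<open>n\<close>.
\<close>

lemma sum_alt_weight_Suc:
  "(\<Sum>k\<le>n div 2. alt_weight (Suc k) * q_binom (n - k) (Suc k)) = q_fib (Suc n) - 1"
proof -
  let ?t = "\<lambda>k. alt_weight k * q_binom (Suc n - k) k"
  have "q_fib (Suc n) = (\<Sum>k\<le>Suc (n div 2). ?t k)"
    unfolding q_fib_def by (rule sum.mono_neutral_left) auto
  also have "\<dots> = 1 + (\<Sum>k\<le>n div 2. ?t (Suc k))"
    by (subst sum.atMost_Suc_shift) simp
  finally show ?thesis by simp
qed

text \<open>
  The upper Pascal rule does not close up on \<open>q_fib\<close>: its second part carries an additional power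
  \<open>q^(n-k)\<close>. The lower Pascal rule, applied to these twisted sums, leads back to \<open>q_fib\<close>.
\<close>

definition q_fib_twisted :: "nat \<Rightarrow> ratfun" where
  "q_fib_twisted n = (\<Sum>k\<le>n div 2. qvar ^ (n - k) * (alt_weight k * q_binom (n - k) k))"

lemma q_fib_Suc_Suc: "q_fib (Suc (Suc n)) = q_fib (Suc n) - q_fib_twisted n"
proof -
  have t: "alt_weight (Suc k) * q_binom (Suc (n - k)) (Suc k)
      = alt_weight (Suc k) * q_binom (n - k) (Suc k)
        - qvar ^ (n - k) * (alt_weight k * q_binom (n - k) k)" if "k \<le> n div 2" for k
  proof -
    have "k + (n - k - k) = n - k" using that by simp
    then have "qvar ^ k * qvar ^ (n - k - k) = qvar ^ (n - k)"
      by (metis power_add)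
    moreover have "k \<le> n - k" using that by simp
    ultimately show ?thesis
      by (simp add: q_pascal_upper alt_weight_Suc algebra_simps)
  qed
  have "q_fib (Suc (Suc n))
      = 1 + (\<Sum>k\<le>n div 2. alt_weight (Suc k) * q_binom (Suc (n - k)) (Suc k))"
    unfolding q_fib_def by (simp add: sum.atMost_Suc_shift Suc_diff_le del: sum.atMost_Suc)
  also have "\<dots> = q_fib (Suc n) - q_fib_twisted n"
    unfolding q_fib_twisted_def by (simp add: t sum_subtractf sum_alt_weight_Suc)
  finally show ?thesis .
qed

lemma q_fib_twisted_Suc_Suc:
  "q_fib_twisted (Suc (Suc n)) = qvar ^ (n + 2) * q_fib (Suc n) - qvar ^ (n + 1) * q_fib n"
proof -
  have t: "qvar ^ Suc (n - k) * (alt_weight (Suc k) * q_binom (Suc (n - k)) (Suc k))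
      = qvar ^ (n + 2) * (alt_weight (Suc k) * q_binom (n - k) (Suc k))
        - qvar ^ (n + 1) * (alt_weight k * q_binom (n - k) k)" if "k \<le> n div 2" for k
  proof -
    have k: "k \<le> n - k" "k \<le> n" using that by auto
    have e1: "qvar ^ (n + 2) = qvar ^ Suc (n - k) * qvar ^ Suc k"
      and e2: "qvar ^ (n + 1) = qvar ^ Suc (n - k) * qvar ^ k"
      unfolding power_add[symmetric] using k by simp_all
    show ?thesis
      unfolding q_pascal_lower[OF k(1)] e1 e2
      by (simp add: alt_weight_Suc algebra_simps del: power_Suc)
  qed
  have "q_fib_twisted (Suc (Suc n)) = qvar ^ (n + 2)
      + (\<Sum>k\<le>n div 2. qvar ^ Suc (n - k) * (alt_weight (Suc k) * q_binom (Suc (n - k)) (Suc k)))"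
    unfolding q_fib_twisted_def
    by (simp add: sum.atMost_Suc_shift Suc_diff_le del: sum.atMost_Suc)
  also have "(\<Sum>k\<le>n div 2. qvar ^ Suc (n - k) * (alt_weight (Suc k) * q_binom (Suc (n - k)) (Suc k)))
      = (\<Sum>k\<le>n div 2. qvar ^ (n + 2) * (alt_weight (Suc k) * q_binom (n - k) (Suc k))
          - qvar ^ (n + 1) * (alt_weight k * q_binom (n - k) k))"
    by (intro sum.cong refl t) simp
  also have "\<dots> = qvar ^ (n + 2) * (q_fib (Suc n) - 1) - qvar ^ (n + 1) * q_fib n"
    by (simp only: sum_subtractf sum_distrib_left[symmetric] sum_alt_weight_Suc
        q_fib_def[of n, symmetric])
  finally show ?thesis by (simp add: algebra_simps)
qed

lemma q_fib_small: "q_fib 0 = 1" "q_fib 1 = 1" "q_fib 2 = 0"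
proof -
  show "q_fib 0 = 1" "q_fib 1 = 1" by (simp_all add: q_fib_def)
  then show "q_fib 2 = 0"
    using q_fib_Suc_Suc[of 0] by (simp add: q_fib_twisted_def numeral_2_eq_2)
qed

text \<open>
  The two recurrences combine to \<open>F\<^sub>n\<^sub>+\<^sub>4 = F\<^sub>n\<^sub>+\<^sub>3 - q^(n+2) F\<^sub>n\<^sub>+\<^sub>1 + q^(n+1) F\<^sub>n\<close>, which says
  exactly that \<open>F\<^sub>n\<^sub>+\<^sub>3 + q^(n+1) F\<^sub>n\<close> does not depend on \<open>n\<close>.
\<close>

lemma q_fib_add_3: "q_fib (n + 3) = - (qvar ^ (n + 1) * q_fib n)"
proof (induction n)
  case 0
  have "q_fib_twisted 1 = qvar" by (simp add: q_fib_twisted_def)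
  then show ?case
    using q_fib_Suc_Suc[of 1] q_fib_small by (simp add: numeral_3_eq_3 numeral_2_eq_2)
next
  case (Suc n)
  have "q_fib (Suc n + 3) = q_fib (n + 3) - q_fib_twisted (n + 2)"
    using q_fib_Suc_Suc[of "n + 2"] by (simp add: numeral_3_eq_3)
  then show ?case
    using Suc.IH q_fib_twisted_Suc_Suc[of n] by simp
qed

lemma q_fib_3m: "q_fib (3 * m) = (-1) ^ m * qvar ^ (m * (3 * m - 1) div 2)"
proof (induction m)
  case (Suc m)
  have "Suc m * (3 * Suc m - 1) = m * (3 * m - 1) + (3 * m + 1) * 2"
    by (cases m) (auto simp: algebra_simps)
  then have "Suc m * (3 * Suc m - 1) div 2 = m * (3 * m - 1) div 2 + (3 * m + 1)"
    by simp
  then show ?case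
    using Suc q_fib_add_3[of "3 * m"] by (simp add: power_add algebra_simps)
qed (simp add: q_fib_small)

lemma q_fib_3m_plus_1: "q_fib (3 * m + 1) = (-1) ^ m * qvar ^ (m * (3 * m + 1) div 2)"
proof (induction m)
  case (Suc m)
  have "Suc m * (3 * Suc m + 1) = m * (3 * m + 1) + (3 * m + 2) * 2"
    by (auto simp: algebra_simps)
  then have "Suc m * (3 * Suc m + 1) div 2 = m * (3 * m + 1) div 2 + (3 * m + 2)"
    by simp
  then show ?case
    using Suc q_fib_add_3[of "3 * m + 1"] by (simp add: power_add algebra_simps)
qed (use q_fib_small in simp)

lemma q_fib_3m_plus_2: "q_fib (3 * m + 2) = 0"
proof (induction m)
  case (Suc m)
  then show ?case
    using q_fib_add_3[of "3 * m + 2"] by (simp add: algebra_simps)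
qed (use q_fib_small in \<open>simp add: numeral_2_eq_2\<close>)

text \<open>
  For \<open>n + 2\<close> congruent to 1 or 2 modulo 3 one of the two \<open>q_fib\<close> values is zero; for a multiple
  of 3 both survive and give the two summands of \<open>1 + q^m\<close>.
\<close>

lemma R_poly_eq_q_fib: "R_poly (n + 2) = q_fib (n + 2) - qvar ^ (n + 1) * q_fib n"
proof -
  consider m where "n = 3 * m" | m where "n = 3 * m + 1" | m where "n = 3 * m + 2"
    by (metis add_0_right mod_less_divisor mult_div_mod_eq numeral_3_eq_3 less_Suc_eq
        One_nat_def numeral_2_eq_2 not_less_zero zero_less_Suc)
  then show ?thesis
  proof cases
    case 1
    have "Suc m * (3 * Suc m - 1) = m * (3 * m - 1) + (3 * m + 1) * 2"
      by (cases m) (auto simp: algebra_simps)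
    then have "Suc m * (3 * Suc m - 1) div 2 = m * (3 * m - 1) div 2 + (3 * m + 1)"
      by simp
    then show ?thesis
      using R_poly_3m_minus_1[of "Suc m"] 1 q_fib_3m[of m] q_fib_3m_plus_2[of m]
      by (simp add: power_add algebra_simps)
  next
    case 2
    have "Suc m * (3 * Suc m - 1) = m * (3 * m + 1) + (2 * m + 1) * 2"
      by (auto simp: algebra_simps)
    then have e: "Suc m * (3 * Suc m - 1) div 2 = m * (3 * m + 1) div 2 + (2 * m + 1)"
      by simp
    have n: "n + 2 = 3 * Suc m" "n + 1 = 3 * m + 2" using 2 by auto
    have p: "qvar ^ (3 * m + 2) * qvar ^ (m * (3 * m + 1) div 2)
        = qvar ^ Suc m * qvar ^ (Suc m * (3 * Suc m - 1) div 2)"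
      unfolding e power_add[symmetric] by (rule arg_cong[of _ _ "power qvar"]) simp
    have "qvar ^ (n + 1) * q_fib n
        = (-1) ^ m * (qvar ^ Suc m * qvar ^ (Suc m * (3 * Suc m - 1) div 2))"
      unfolding n(2) p[symmetric] 2 q_fib_3m_plus_1 by (simp add: mult_ac)
    then show ?thesis
      unfolding n(1) R_poly_3m q_fib_3m by (simp add: algebra_simps)
  next
    case 3
    then have n: "n + 2 = 3 * Suc m + 1" by simp
    show ?thesis
      unfolding n R_poly_3m_plus_1 q_fib_3m_plus_1 using 3 q_fib_3m_plus_2[of m] by simp
  qed
qed

text \<open>
  The term \<open>k = 0\<close> of the Lucas-type sum for \<open>R_poly n\<close> is 1, and moving it to the left leaves only
  terms that carry the factor \<open>1 - q^n\<close> explicitly.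
\<close>

lemma one_minus_R_poly_sum:
  assumes "n > 0"
  shows "(1 - R_poly n) / (1 - qvar ^ n)
    = (\<Sum>k=1..n div 2. - (alt_weight k * q_binom (n - k) k) / (1 - qvar ^ (n - k)))"
proof (cases "n = 1")
  case True
  \<comment> \<open>The expression through \<open>q_fib (n - 2)\<close> needs \<open>n \<ge> 2\<close>; here the sum is empty and
    \<open>R_poly 1 = 1\<close>.\<close>
  then show ?thesis using R_poly_3m_plus_1[of 0] by simp
next
  case False
  define m where "m = n - 2"
  have n: "n = Suc (Suc m)" using assms False by (simp add: m_def)
  have t: "(1 - qvar ^ n) * (alt_weight (Suc k) * q_binom (n - Suc k) (Suc k) / (1 - qvar ^ (n - Suc k)))
      = alt_weight (Suc k) * q_binom (n - Suc k) (Suc k)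
        - qvar ^ (m + 1) * (alt_weight k * q_binom (m - k) k)" if "k \<le> m div 2" for k
  proof -
    have k: "k \<le> m" and nk: "n - Suc k = Suc (m - k)" using that n by auto
    have q1: "qvar ^ n = qvar ^ Suc (m - k) * qvar ^ Suc k"
      and q2: "qvar ^ (m + 1) = qvar ^ Suc (m - k) * qvar ^ k"
      unfolding power_add[symmetric] using k n by simp_all
    have nz: "1 - qvar ^ Suc (m - k) \<noteq> 0" by (rule one_minus_qvar_power_nonzero) simp
    \<comment> \<open>\<open>1 - q^n\<close> is split along \<open>n = (n - (k + 1)) + (k + 1)\<close>; absorption turns the second part
      into a term of \<open>q_fib m\<close>.\<close>
    have "(1 - qvar ^ n) * q_binom (Suc (m - k)) (Suc k)
        = (1 - qvar ^ Suc (m - k)) * q_binom (Suc (m - k)) (Suc k)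
          + qvar ^ Suc (m - k) * ((1 - qvar ^ Suc k) * q_binom (Suc (m - k)) (Suc k))"
      unfolding q1 by (simp add: algebra_simps)
    also have "\<dots> = (1 - qvar ^ Suc (m - k))
        * (q_binom (Suc (m - k)) (Suc k) + qvar ^ Suc (m - k) * q_binom (m - k) k)"
      unfolding q_binom_absorption by (simp add: algebra_simps)
    finally have "(1 - qvar ^ n) * (q_binom (Suc (m - k)) (Suc k) / (1 - qvar ^ Suc (m - k)))
        = q_binom (Suc (m - k)) (Suc k) + qvar ^ Suc (m - k) * q_binom (m - k) k"
      using nz by (simp add: field_simps)
    then have "alt_weight (Suc k) * ((1 - qvar ^ n)
          * (q_binom (Suc (m - k)) (Suc k) / (1 - qvar ^ Suc (m - k))))
        = alt_weight (Suc k) * q_binom (Suc (m - k)) (Suc k)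
          - qvar ^ (m + 1) * (alt_weight k * q_binom (m - k) k)"
      unfolding q2 by (simp add: alt_weight_Suc algebra_simps del: power_Suc)
    then show ?thesis unfolding nk by (simp add: mult.left_commute)
  qed
  have fib: "q_fib n = 1 + (\<Sum>k\<le>m div 2. alt_weight (Suc k) * q_binom (n - Suc k) (Suc k))"
    unfolding q_fib_def n by (simp add: sum.atMost_Suc_shift del: sum.atMost_Suc)
  have "(1 - qvar ^ n) * (\<Sum>k=1..n div 2. alt_weight k * q_binom (n - k) k / (1 - qvar ^ (n - k)))
      = (\<Sum>k\<le>m div 2. (1 - qvar ^ n) *
          (alt_weight (Suc k) * q_binom (n - Suc k) (Suc k) / (1 - qvar ^ (n - Suc k))))"
    unfolding sum_distrib_left[symmetric] n atMost_atLeast0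
    by (simp add: sum.shift_bounds_cl_Suc_ivl del: power_Suc sum.cl_ivl_Suc)
  also have "\<dots> = (\<Sum>k\<le>m div 2. alt_weight (Suc k) * q_binom (n - Suc k) (Suc k)
        - qvar ^ (m + 1) * (alt_weight k * q_binom (m - k) k))"
    by (intro sum.cong refl t) simp
  also have "\<dots> = q_fib n - 1 - qvar ^ (m + 1) * q_fib m"
    unfolding fib by (simp add: sum_subtractf sum_distrib_left q_fib_def[of m] del: power_Suc)
  also have "\<dots> = R_poly n - 1"
    using R_poly_eq_q_fib[of m] n by simp
  finally show ?thesis
    using one_minus_qvar_power_nonzero[OF assms] by (simp add: field_simps sum_negf)
qed

section \<open>Divisibility by and coprimality with the cyclotomic polynomial\<close>

lemma cyclotomic_dvd:
  assumes "n > 0"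
  shows "cyclotomic n dvd monom 1 n - 1"
proof -
  have "map_poly (of_int :: int \<Rightarrow> complex) (\<Prod>d | d dvd n. cyclotomic (n div d))
      = map_poly of_int (monom 1 n - 1)"
    using prod_cyclotomic_complex[OF assms]
    by (simp add: of_int_poly_prod of_int_cyclotomic of_int_poly_diff map_poly_monom)
  then have "(\<Prod>d | d dvd n. cyclotomic (n div d)) = monom 1 n - 1"
    unfolding of_int_poly_inject .
  moreover have "cyclotomic (n div 1) dvd (\<Prod>d | d dvd n. cyclotomic (n div d))"
    using assms by (intro dvd_prodI) auto
  ultimately show ?thesis by simp
qed

lemma lead_coeff_cyclotomic: "lead_coeff (cyclotomic n) = 1"
proof -
  have "lead_coeff (map_poly of_int (cyclotomic n) :: complex poly) = 1"
    unfolding of_int_cyclotomic cyclotomic_complex_altdef by (rule monic_prod_linear)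
  then show ?thesis by (simp add: degree_of_int_poly coeff_map_poly)
qed

lemma cyclotomic_complex_root_primitive:
  assumes "poly (cyclotomic_complex n) z = 0" and "z ^ i = 1"
  shows "n dvd i"
proof -
  from assms(1) obtain k where k: "k \<in> totatives n" and z: "z = cis (2 * pi * real k / real n)"
    by (auto simp: cyclotomic_complex_altdef poly_prod)
  have n: "n > 0" using k by (auto simp: totatives_def)
  have "cos (real i * (2 * pi * real k / real n)) = 1"
    using assms(2) unfolding z DeMoivre by (metis cis.sel(1) one_complex.sel(1))
  then obtain m :: int where "real i * (2 * pi * real k / real n) = of_int m * 2 * pi"
    using cos_one_2pi_int by blast
  then have "real i * real k = of_int m * real n"
    using n by (simp add: field_simps)
  then have "of_int (int i * int k) = (of_int (m * int n) :: real)" by simp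
  then have "int i * int k = m * int n" unfolding of_int_eq_iff .
  then have "int n dvd int (i * k)" by simp
  then have "n dvd i * k" unfolding int_dvd_int_iff .
  moreover have "coprime n k" using k by (simp add: totatives_def coprime_commute)
  ultimately show ?thesis by (simp add: coprime_dvd_mult_left_iff)
qed

text \<open>
  Over the integers, the absence of common complex roots only forces a common divisor to be constant.
  It is then a unit because \<open>\<Phi>\<^sub>n\<close> is monic.
\<close>

lemma coprime_cyclotomicI:
  assumes "\<And>z. poly (cyclotomic_complex n) z = 0 \<Longrightarrow> poly (map_poly of_int p) z \<noteq> 0"
  shows "coprime p (cyclotomic n)"
proof (rule coprimeI)
  fix d :: "int poly"
  assume d: "d dvd p" "d dvd cyclotomic n"
  then obtain a b where ab: "p = d * a" "cyclotomic n = d * b" by (auto elim!: dvdE)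
  have "degree d = 0"
  proof (rule ccontr)
    assume "degree d \<noteq> 0"
    then have "\<not> constant (poly (map_poly of_int d :: complex poly))"
      by (simp add: constant_degree degree_of_int_poly)
    then obtain z where z: "poly (map_poly of_int d :: complex poly) z = 0"
      using fundamental_theorem_of_algebra by blast
    have "poly (cyclotomic_complex n) z = 0"
      using z by (simp add: ab(2) of_int_poly_mult flip: of_int_cyclotomic)
    moreover have "poly (map_poly of_int p) z = 0"
      using z by (simp add: ab(1) of_int_poly_mult)
    ultimately show False using assms by blast
  qed
  then obtain c where c: "d = [:c:]" by (rule degree_eq_zeroE)
  have "lead_coeff d * lead_coeff b = 1"
    using lead_coeff_cyclotomic[of n] unfolding ab(2) lead_coeff_mult .
  then have "c * lead_coeff b = 1" by (simp add: c)
  then have "c dvd 1" by (metis dvd_triv_left)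
  then show "d dvd 1" unfolding c by (simp add: is_unit_const_poly_iff)
qed

lemma coprime_monom_cyclotomic:
  assumes "n > 0"
  shows "coprime (monom 1 k) (cyclotomic n)"
proof (rule coprime_cyclotomicI)
  fix z assume "poly (cyclotomic_complex n) z = 0"
  then have "z \<noteq> 0" by (auto simp: cyclotomic_complex_altdef poly_prod totatives_def)
  then show "poly (map_poly of_int (monom 1 k)) z \<noteq> 0"
    by (simp add: map_poly_monom poly_monom)
qed

lemma coprime_one_minus_monom_cyclotomic:
  assumes "\<not> n dvd i"
  shows "coprime (1 - monom 1 i) (cyclotomic n)"
proof (rule coprime_cyclotomicI)
  fix z assume "poly (cyclotomic_complex n) z = 0"
  then have "z ^ i \<noteq> 1" using cyclotomic_complex_root_primitive assms by blast
  then show "poly (map_poly of_int (1 - monom 1 i)) z \<noteq> 0"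
    by (simp add: of_int_poly_diff map_poly_monom poly_monom)
qed

section \<open>The congruence\<close>

lemma ratfun_cong_refl: "ratfun_cong A A P"
  unfolding ratfun_cong_def by (intro exI[of _ 0] exI[of _ 1]) auto

lemma ratfun_cong_add:
  assumes "ratfun_cong A B P" "ratfun_cong C D P"
  shows "ratfun_cong (A + C) (B + D) P"
proof -
  obtain a b c d where *: "b \<noteq> 0" "A - B = to_fract a / to_fract b" "P dvd a" "coprime b P"
    "d \<noteq> 0" "C - D = to_fract c / to_fract d" "P dvd c" "coprime d P"
    using assms unfolding ratfun_cong_def by blast
  have "(A + C) - (B + D) = (A - B) + (C - D)" by simp
  also have "\<dots> = to_fract (a * d + c * b) / to_fract (b * d)"
    using * by (simp add: add_frac_eq)
  finally show ?thesis
    unfolding ratfun_cong_def using *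
    by (intro exI[of _ "a * d + c * b"] exI[of _ "b * d"]) auto
qed

lemma ratfun_cong_sum:
  assumes "\<And>x. x \<in> S \<Longrightarrow> ratfun_cong (f x) (g x) P"
  shows "ratfun_cong (sum f S) (sum g S) P"
  using assms by (induction S rule: infinite_finite_induct)
    (auto intro: ratfun_cong_refl ratfun_cong_add)

lemma dvd_prod_diff:
  fixes f g :: "'a \<Rightarrow> 'b :: comm_ring_1"
  assumes "\<And>x. x \<in> S \<Longrightarrow> p dvd f x - g x"
  shows "p dvd prod f S - prod g S"
  using assms
proof (induction S rule: infinite_finite_induct)
  case (insert x S)
  have "prod f (insert x S) - prod g (insert x S)
      = f x * (prod f S - prod g S) + (f x - g x) * prod g S"
    using insert by (simp add: algebra_simps)
  then show ?case using insert by auto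
qed auto

text \<open>
  Bringing the terms of both sums to the same denominator. The factor \<open>1 - q^(2k)\<close> of the binomial
  cancels against \<open>[2k]\<^sub>q\<close>; it is divisible by \<open>\<Phi>\<^sub>n\<close> when \<open>2 k = n\<close>, so this has to happen before
  anything is reduced modulo \<open>\<Phi>\<^sub>n\<close>.
\<close>

lemma central_term_eq:
  assumes "k > 0"
  shows "qvar powi (- (int k * (int k - 1))) / q_int (2 * k) * q_binom (2 * k) k
    = (1 - qvar) * (\<Prod>j\<in>{k<..<2 * k}. 1 - qvar ^ j)
      / (qvar ^ (k * (k - 1)) * (\<Prod>i=1..k. 1 - qvar ^ i))"
proof -
  have "(\<Prod>i<k. 1 - qvar ^ (2 * k - i)) = (\<Prod>j\<in>{k<..2 * k}. 1 - qvar ^ j)"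
    by (rule prod.reindex_bij_witness[of _ "\<lambda>j. 2 * k - j" "\<lambda>i. 2 * k - i"]) auto
  also have "{k<..2 * k} = insert (2 * k) {k<..<2 * k}" using assms by auto
  finally have p: "(\<Prod>i<k. 1 - qvar ^ (2 * k - i))
      = (1 - qvar ^ (2 * k)) * (\<Prod>j\<in>{k<..<2 * k}. 1 - qvar ^ j)" by simp
  have e: "- (int k * (int k - 1)) = - int (k * (k - 1))"
    using assms by (simp add: of_nat_diff)
  have nz: "1 - qvar ^ (2 * k) \<noteq> 0" using assms by (intro one_minus_qvar_power_nonzero) simp
  show ?thesis
    unfolding q_binom_altdef p q_int_def e power_int_minus power_int_of_nat
    using nz by (simp add: field_simps)
qed

text \<open>
  Pulling \<open>- q^j\<close> out of each \<open>q^n - q^j\<close> leaves the numerator factors \<open>1 - q^(n-j)\<close> of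
  \<open>[n - k, k]\<close>, except for the factor \<open>j = k\<close>, which the denominator \<open>1 - q^(n-k)\<close> cancels. The
  extracted powers have total exponent \<open>(k + 1) + \<dots> + (2 k - 1) = 3 k (k - 1) / 2\<close>, that is
  \<open>k (k - 1)\<close> for the common denominator plus \<open>k (k - 1) / 2\<close> for \<open>alt_weight k\<close>.
\<close>

lemma lucas_term_eq:
  assumes "k > 0" and "2 * k \<le> n"
  shows "- (alt_weight k * q_binom (n - k) k) / (1 - qvar ^ (n - k))
    = (\<Prod>j\<in>{k<..<2 * k}. qvar ^ n - qvar ^ j)
      / (qvar ^ (k * (k - 1)) * (\<Prod>i=1..k. 1 - qvar ^ i))"
proof -
  have "(\<Prod>i<k. 1 - qvar ^ (n - k - i)) = (\<Prod>j\<in>{k..<2 * k}. 1 - qvar ^ (n - j))"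
    by (rule prod.reindex_bij_witness[of _ "\<lambda>j. j - k" "\<lambda>i. i + k"]) (auto simp: add.commute)
  also have "{k..<2 * k} = insert k {k<..<2 * k}" using assms by auto
  finally have p: "(\<Prod>i<k. 1 - qvar ^ (n - k - i))
      = (1 - qvar ^ (n - k)) * (\<Prod>j\<in>{k<..<2 * k}. 1 - qvar ^ (n - j))" by simp
  have nz: "1 - qvar ^ (n - k) \<noteq> 0" using assms by (intro one_minus_qvar_power_nonzero) simp
  have w: "(\<Prod>j\<in>{k<..<2 * k}. - (qvar ^ j)) = - (qvar ^ (k * (k - 1)) * alt_weight k)"
  proof -
    have s: "2 * (\<Sum>j\<in>{k<..<2 * k}. j) = 3 * (k * (k - 1))" for k :: nat
    proof (induction k)
      case (Suc k)
      \<comment> \<open>Passing from \<open>k\<close> to \<open>k + 1\<close> drops \<open>k + 1\<close> from the range of \<open>j\<close> and adds \<open>2 k\<close> and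
        \<open>2 k + 1\<close>. For \<open>k = 0\<close> this fails, but then both ranges are empty.\<close>
      show ?case
      proof (cases k)
        case (Suc l)
        have "insert (Suc k) {Suc k<..<2 * Suc k} = insert (2 * k) (insert (2 * k + 1) {k<..<2 * k})"
          using Suc by auto
        then have "\<Sum> (insert (Suc k) {Suc k<..<2 * Suc k})
            = \<Sum> (insert (2 * k) (insert (2 * k + 1) {k<..<2 * k}))" by simp
        then have "Suc k + \<Sum>{Suc k<..<2 * Suc k} = 4 * k + 1 + \<Sum>{k<..<2 * k}" by simp
        then show ?thesis using Suc.IH Suc by (simp add: algebra_simps)
      qed auto
    qed auto
    have c: "2 * (k choose 2) = k * (k - 1)"
      unfolding choose_two by (rule dvd_mult_div_cancel) (cases k; simp)
    have "(\<Sum>j\<in>{k<..<2 * k}. j) = k * (k - 1) + (k choose 2)"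
      using s[of k] c by simp
    moreover have "(-1 :: ratfun) ^ (k - 1) = - ((-1) ^ k)"
      using assms(1) by (cases k) auto
    moreover have "(\<Prod>j\<in>{k<..<2 * k}. - (qvar ^ j))
        = (-1) ^ (k - 1) * qvar ^ (\<Sum>j\<in>{k<..<2 * k}. j)"
      by (simp add: power_sum prod_uminus)
    ultimately show ?thesis
      by (simp add: alt_weight_def power_add)
  qed
  have "(\<Prod>j\<in>{k<..<2 * k}. qvar ^ n - qvar ^ j)
      = (\<Prod>j\<in>{k<..<2 * k}. - (qvar ^ j) * (1 - qvar ^ (n - j)))"
  proof (rule prod.cong)
    fix j assume "j \<in> {k<..<2 * k}"
    then have "qvar ^ n = qvar ^ j * qvar ^ (n - j)"
      using assms by (simp flip: power_add)
    then show "qvar ^ n - qvar ^ j = - (qvar ^ j) * (1 - qvar ^ (n - j))"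
      by (simp add: algebra_simps)
  qed simp
  also have "\<dots> = - (qvar ^ (k * (k - 1)) * alt_weight k) * (\<Prod>j\<in>{k<..<2 * k}. 1 - qvar ^ (n - j))"
    unfolding prod.distrib w ..
  finally show ?thesis
    unfolding q_binom_altdef p using nz by (simp add: field_simps)
qed

lemma term_cong:
  assumes "k > 0" and "2 * k \<le> n"
  shows "ratfun_cong (qvar powi (- (int k * (int k - 1))) / q_int (2 * k) * q_binom (2 * k) k)
    ((1 - qvar) * (- (alt_weight k * q_binom (n - k) k) / (1 - qvar ^ (n - k)))) (cyclotomic n)"
proof -
  let ?J = "{k<..<2 * k}"
  let ?m = "monom (1 :: int)"
  define N where "N = (1 - ?m 1) * ((\<Prod>j\<in>?J. 1 - ?m j) - (\<Prod>j\<in>?J. ?m n - ?m j))"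
  define D where "D = ?m (k * (k - 1)) * (\<Prod>i=1..k. 1 - ?m i)"
  have n: "n > 0" using assms by simp
  have DF: "to_fract D = qvar ^ (k * (k - 1)) * (\<Prod>i=1..k. 1 - qvar ^ i)"
    by (simp add: D_def to_fract_prod qvar_power)
  have "to_fract D \<noteq> 0" unfolding DF by simp
  then have "D \<noteq> 0" by auto
  moreover have "qvar powi (- (int k * (int k - 1))) / q_int (2 * k) * q_binom (2 * k) k
      - (1 - qvar) * (- (alt_weight k * q_binom (n - k) k) / (1 - qvar ^ (n - k)))
      = to_fract N / to_fract D"
    unfolding central_term_eq[OF assms(1)] lucas_term_eq[OF assms] DF
    by (simp add: N_def to_fract_prod right_diff_distrib diff_divide_distrib
        flip: qvar_power)
  moreover have "cyclotomic n dvd N"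
  proof -
    have "cyclotomic n dvd (1 - ?m j) - (?m n - ?m j)" for j
      using cyclotomic_dvd[OF n] dvd_minus_iff[of "cyclotomic n" "?m n - 1"] by simp
    then show ?thesis unfolding N_def by (intro dvd_mult dvd_prod_diff)
  qed
  moreover have "coprime D (cyclotomic n)"
  proof -
    have "coprime (1 - ?m i) (cyclotomic n)" if "i \<in> {1..k}" for i
      using that assms by (intro coprime_one_minus_monom_cyclotomic) (auto dest!: dvd_imp_le)
    then have "coprime (\<Prod>i=1..k. 1 - ?m i) (cyclotomic n)"
      by (rule prod_coprime_left)
    then show ?thesis
      unfolding D_def using coprime_monom_cyclotomic[OF n] by simp
  qed
  ultimately show ?thesis unfolding ratfun_cong_def by blast
qed

theorem proposition2p3:
  fixes n :: nat
  assumes "n > 0"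
  shows "ratfun_cong
           (\<Sum>k = 1..n div 2. qvar powi (- (int k * (int k - 1))) / q_int (2 * k) * q_binom (2 * k) k)
           ((1 - qvar) * (1 - R_poly n) / (1 - qvar ^ n))
           (cyclotomic n)"
proof -
  have "(1 - qvar) * (1 - R_poly n) / (1 - qvar ^ n)
      = (\<Sum>k=1..n div 2. (1 - qvar)
          * (- (alt_weight k * q_binom (n - k) k) / (1 - qvar ^ (n - k))))"
    using one_minus_R_poly_sum[OF assms]
    by (simp only: sum_distrib_left[symmetric] times_divide_eq_right[symmetric])
  moreover have "ratfun_cong
      (\<Sum>k=1..n div 2. qvar powi (- (int k * (int k - 1))) / q_int (2 * k) * q_binom (2 * k) k)
      (\<Sum>k=1..n div 2. (1 - qvar)
          * (- (alt_weight k * q_binom (n - k) k) / (1 - qvar ^ (n - k))))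
      (cyclotomic n)"
    by (intro ratfun_cong_sum term_cong) auto
  ultimately show ?thesis by simp
qed

end
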